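(* Let $k\ge 2$ and let $\{x_j\}_{j=1}^k,\{y_j\}_{j=1}^k,\{w_j\}_{j=1}^k,\{z_j\}_{j=1}^k$ be finite sequences of non-negative integers such that $x_j+y_j=w_j+z_j=j$ and $\{x_j,y_j\}\neq\{w_j,z_j\}$ for every $2\leq j\leq k$. Then there exists a finite set $A\subset\mathbb{Z}^2$ satisfying $|x_jA-y_jA|>|w_jA-z_jA|$ for every $2\leq j\leq k$.
   Context: For a finite set $A\subset\mathbb{Z}^2$ and non-negative integers $s,d$, $sA-dA=\{u_1+\cdots+u_s-v_1-\cdots-v_d: u_i,v_j\in A\}$ (empty sums equal $0$). *)

theory Defs
  imports Main "HOL-Library.Product_Plus"
begin

definition sum_diff_set :: "nat \<Rightarrow> nat \<Rightarrow> 'a::ab_group_add set \<Rightarrow> 'a set" where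
  "sum_diff_set s d A =
     {(\<Sum>i<s. u i) - (\<Sum>j<d. v j) | u v. (\<forall>i<s. u i \<in> A) \<and> (\<forall>j<d. v j \<in> A)}"

end

theory Submission
  imports Defs "HOL-Number_Theory.Cong" "HOL-Library.FuncSet"
begin

text \<open>Intersecting a set \<open>S\<close> of integers that is periodic modulo \<open>m\<close> with a long interval turns the
  number of residues modulo \<open>m\<close> in \<open>s S - d S\<close> into the leading term of the cardinality of the
  corresponding finite sum-difference set, so it suffices to find a periodic \<open>S\<close> with the required
  inequalities between numbers of residues. By the Chinese remainder theorem, intersecting sets with
  coprime periods multiplies these numbers. Hence the levels can be treated one at a time, given
  for each level \<open>j = w + z\<close> a periodic \<open>S\<close> for which \<open>w S - z S\<close> has arbitrarily small density, while
  \<open>x S - y S\<close> is everything for all other \<open>{x, y}\<close> with \<open>x + y = j\<close> and whenever \<open>x + y > j\<close>.\<close>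

section \<open>Sum-difference sets as signed sums\<close>

text \<open>Serves to move a set of integers into the plane along \<open>n \<mapsto> (n, 0)\<close>;
  all counting then takes place in the integers.\<close>

lemma sum_diff_set_image:
  fixes f :: "'a::ab_group_add \<Rightarrow> 'b::ab_group_add"
  assumes add: "\<And>a b. f (a + b) = f a + f b"
  shows "sum_diff_set s d (f ` A) = f ` sum_diff_set s d A"
proof -
  have f0: "f 0 = 0"
    using add[of 0 0] by simp
  have fminus: "f (- a) = - f a" for a
    using add[of a "- a"] f0 by (simp add: eq_neg_iff_add_eq_0 add.commute)
  have fdiff: "f (a - b) = f a - f b" for a b
    using add[of a "- b"] fminus by simp
  have fsum: "f (\<Sum>i<n. u i) = (\<Sum>i<n. f (u i))" for n :: nat and u
    by (induction n) (simp_all add: f0 add)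
  show ?thesis
  proof (intro set_eqI iffI)
    fix b assume "b \<in> sum_diff_set s d (f ` A)"
    then obtain u v where b: "b = (\<Sum>i<s. u i) - (\<Sum>j<d. v j)"
      and u: "\<forall>i<s. u i \<in> f ` A" and v: "\<forall>j<d. v j \<in> f ` A"
      unfolding sum_diff_set_def by blast
    have "\<forall>i. \<exists>a. i < s \<longrightarrow> a \<in> A \<and> u i = f a"
      using u by blast
    then obtain u' where u': "\<forall>i<s. u' i \<in> A \<and> u i = f (u' i)"
      using choice[of "\<lambda>i a. i < s \<longrightarrow> a \<in> A \<and> u i = f a"] by blast
    have "\<forall>i. \<exists>a. i < d \<longrightarrow> a \<in> A \<and> v i = f a"
      using v by blast
    then obtain v' where v': "\<forall>i<d. v' i \<in> A \<and> v i = f (v' i)"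
      using choice[of "\<lambda>i a. i < d \<longrightarrow> a \<in> A \<and> v i = f a"] by blast
    have "b = f ((\<Sum>i<s. u' i) - (\<Sum>j<d. v' j))"
      using b u' v' by (simp add: fdiff fsum)
    with u' v' show "b \<in> f ` sum_diff_set s d A"
      unfolding sum_diff_set_def by blast
  next
    fix b assume "b \<in> f ` sum_diff_set s d A"
    then obtain u v where b: "b = f ((\<Sum>i<s. u i) - (\<Sum>j<d. v j))"
      and u: "\<forall>i<s. u i \<in> A" and v: "\<forall>j<d. v j \<in> A"
      unfolding sum_diff_set_def by blast
    have "b = (\<Sum>i<s. f (u i)) - (\<Sum>j<d. f (v j))"
      using b by (simp add: fdiff fsum)
    moreover have "\<forall>i<s. f (u i) \<in> f ` A" "\<forall>j<d. f (v j) \<in> f ` A"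
      using u v by simp_all
    ultimately show "b \<in> sum_diff_set s d (f ` A)"
      unfolding sum_diff_set_def
      by (intro CollectI exI[of _ "\<lambda>i. f (u i)"] exI[of _ "\<lambda>i. f (v i)"]) blast
  qed
qed

text \<open>With signs attached to the indices, the two families of summands become one family of
  length \<open>s + d\<close>, so residues can be prescribed for all summands uniformly.\<close>

definition sg :: "nat \<Rightarrow> nat \<Rightarrow> int" where
  "sg s i = (if i < s then 1 else -1)"

lemma sg_square [simp]: "sg s i * sg s i = 1" "sg s i * (sg s i * a) = a"
  by (simp_all add: sg_def)

lemma sum_sg: "(\<Sum>i<s+d. sg s i * u i) = (\<Sum>i<s. u i) - (\<Sum>j<d. u (s + j))"
proof (induction d)
  case 0
  show ?case by (simp add: sg_def)
next
  case (Suc d)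
  then show ?case by (simp add: sg_def)
qed

lemma mem_sum_diff_set_iff:
  fixes A :: "int set"
  shows "g \<in> sum_diff_set s d A \<longleftrightarrow> (\<exists>u. (\<forall>i<s+d. u i \<in> A) \<and> g = (\<Sum>i<s+d. sg s i * u i))"
proof
  assume "g \<in> sum_diff_set s d A"
  then obtain u v where g: "g = (\<Sum>i<s. u i) - (\<Sum>j<d. v j)"
    and u: "\<forall>i<s. u i \<in> A" and v: "\<forall>j<d. v j \<in> A"
    unfolding sum_diff_set_def by blast
  let ?u = "\<lambda>i. if i < s then u i else v (i - s)"
  have "g = (\<Sum>i<s+d. sg s i * ?u i)"
    unfolding sum_sg by (simp add: g)
  moreover have "\<forall>i<s+d. ?u i \<in> A"
    using u v by auto
  ultimately show "\<exists>u. (\<forall>i<s+d. u i \<in> A) \<and> g = (\<Sum>i<s+d. sg s i * u i)"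
    by (intro exI[of _ ?u]) blast
next
  assume "\<exists>u. (\<forall>i<s+d. u i \<in> A) \<and> g = (\<Sum>i<s+d. sg s i * u i)"
  then obtain u where u: "\<forall>i<s+d. u i \<in> A" and g: "g = (\<Sum>i<s+d. sg s i * u i)"
    by blast
  have "g = (\<Sum>i<s. u i) - (\<Sum>j<d. u (s + j))"
    using g by (simp only: sum_sg)
  moreover have "\<forall>i<s. u i \<in> A" "\<forall>j<d. u (s + j) \<in> A"
    using u by auto
  ultimately show "g \<in> sum_diff_set s d A"
    unfolding sum_diff_set_def
    by (intro CollectI exI[of _ u] exI[of _ "\<lambda>j. u (s + j)"]) blast
qed

lemma zero_in_sum_diff_set: "0 \<in> A \<Longrightarrow> (0::int) \<in> sum_diff_set s d A"
  unfolding mem_sum_diff_set_iff by (intro exI[of _ "\<lambda>_. 0"]) simp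

lemma sum_diff_set_mono: "A \<subseteq> B \<Longrightarrow> sum_diff_set s d A \<subseteq> sum_diff_set s d B"
  unfolding sum_diff_set_def by blast

section \<open>Chinese remaindering and periodic sets\<close>

lemma chinese_remainder_int:
  fixes m :: "'a \<Rightarrow> nat" and u :: "'a \<Rightarrow> int"
  assumes "finite A" "\<And>a b. a \<in> A \<Longrightarrow> b \<in> A \<Longrightarrow> a \<noteq> b \<Longrightarrow> coprime (m a) (m b)"
    and pos: "\<And>a. a \<in> A \<Longrightarrow> m a > 0"
  shows "\<exists>x. \<forall>a\<in>A. [x = u a] (mod int (m a))"
proof -
  obtain x where x: "\<forall>a\<in>A. [x = nat (u a mod int (m a))] (mod m a)"
    using chinese_remainder_nat[of A m "\<lambda>a. nat (u a mod int (m a))"] assms by blast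
  have "[int x = u a] (mod int (m a))" if "a \<in> A" for a
  proof -
    have "[int x = int (nat (u a mod int (m a)))] (mod int (m a))"
      using x that unfolding cong_int_iff by blast
    then show ?thesis
      using pos[OF that] by (simp add: cong_def)
  qed
  then show ?thesis by blast
qed

text \<open>All summands but the first come from the Chinese remainder theorem; the first one is then
  forced, and automatically lies in the prescribed residue classes.\<close>

lemma signed_sum_local_global:
  fixes m :: "'a \<Rightarrow> nat" and c :: "'a \<Rightarrow> nat \<Rightarrow> int"
  assumes fin: "finite Q" and cop: "\<And>a b. a \<in> Q \<Longrightarrow> b \<in> Q \<Longrightarrow> a \<noteq> b \<Longrightarrow> coprime (m a) (m b)"
    and pos: "\<And>a. a \<in> Q \<Longrightarrow> m a > 0" and l: "l > 0"
    and loc: "\<And>a. a \<in> Q \<Longrightarrow> [(\<Sum>i<l. sg s i * c a i) = g] (mod int (m a))"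
  shows "\<exists>n. (\<Sum>i<l. sg s i * n i) = g \<and> (\<forall>i<l. \<forall>a\<in>Q. [n i = c a i] (mod int (m a)))"
proof -
  have "\<exists>x. \<forall>a\<in>Q. [x = c a i] (mod int (m a))" for i
    using chinese_remainder_int[OF fin cop pos] .
  then obtain y where y: "\<And>i a. a \<in> Q \<Longrightarrow> [y i = c a i] (mod int (m a))"
    by metis
  let ?R = "{..<l} - {0}"
  have split: "(\<Sum>i<l. f i) = f 0 + (\<Sum>i\<in>?R. f i)" for f :: "nat \<Rightarrow> int"
    using l by (subst sum.remove[of "{..<l}" 0]) auto
  define n where "n i = (if i = 0 then sg s 0 * (g - (\<Sum>i\<in>?R. sg s i * y i)) else y i)" for i
  have "(\<Sum>i<l. sg s i * n i) = g"
    unfolding split by (simp add: n_def)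
  moreover have "[n i = c a i] (mod int (m a))" if "i < l" "a \<in> Q" for i a
  proof (cases "i = 0")
    case False
    then show ?thesis using y that by (simp add: n_def)
  next
    case True
    have "[g - (\<Sum>i\<in>?R. sg s i * y i)
           = (\<Sum>i<l. sg s i * c a i) - (\<Sum>i\<in>?R. sg s i * c a i)] (mod int (m a))"
      by (intro cong_diff cong_sum cong_scalar_left cong_sym[OF loc] y that)
    then have "[sg s 0 * (g - (\<Sum>i\<in>?R. sg s i * y i)) = sg s 0 * (sg s 0 * c a 0)] (mod int (m a))"
      by (intro cong_scalar_left) (simp add: split)
    then show ?thesis using True by (simp add: n_def)
  qed
  ultimately show ?thesis by blast
qed

definition periodic :: "nat \<Rightarrow> int set \<Rightarrow> bool" where
  "periodic m S \<longleftrightarrow> (\<forall>a b. [a = b] (mod int m) \<longrightarrow> a \<in> S \<longrightarrow> b \<in> S)"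

lemma periodicD: "periodic m S \<Longrightarrow> [a = b] (mod int m) \<Longrightarrow> a \<in> S \<Longrightarrow> b \<in> S"
  unfolding periodic_def by blast

lemma periodic_mod: "periodic m S \<Longrightarrow> a mod int m \<in> S \<longleftrightarrow> a \<in> S"
  by (metis periodicD cong_mod_left cong_refl cong_sym)

text \<open>Moving from \<open>a\<close> to a congruent \<open>b\<close> only requires changing the
  summands within their classes modulo \<open>m\<close>, which is local-global solvability for a
  single modulus. At least one summand is essential: the empty signed sum only gives 0.\<close>

lemma periodic_sum_diff_set:
  assumes S: "periodic m S" and "m > 0" "s + d > 0"
  shows "periodic m (sum_diff_set s d S)"
  unfolding periodic_def
proof (intro allI impI)
  fix a b assume ab: "[a = b] (mod int m)" and "a \<in> sum_diff_set s d S"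
  then obtain u where u: "\<forall>i<s+d. u i \<in> S" and a: "a = (\<Sum>i<s+d. sg s i * u i)"
    unfolding mem_sum_diff_set_iff by blast
  obtain n where n: "(\<Sum>i<s+d. sg s i * n i) = b" "\<forall>i<s+d. [n i = u i] (mod int m)"
    using signed_sum_local_global[of "{()}" "\<lambda>_. m" "s + d" s "\<lambda>_. u" b] assms ab a by auto
  have "\<forall>i<s+d. n i \<in> S"
    using n u S periodicD cong_sym by metis
  with n show "b \<in> sum_diff_set s d S"
    unfolding mem_sum_diff_set_iff by blast
qed

text \<open>A representation of \<open>g\<close> over \<open>S\<close> and one over
  \<open>S'\<close> are merged summand by summand: the new summands follow the first modulo
  \<open>m\<close> and the second modulo \<open>m'\<close>, while the sum stays exactly
  \<open>g\<close>.\<close>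

lemma sum_diff_set_Int:
  assumes S: "periodic m S" "m > 0" and S': "periodic m' S'" "m' > 0"
    and cop: "coprime m m'" and pos: "s + d > 0"
  shows "sum_diff_set s d (S \<inter> S') = sum_diff_set s d S \<inter> sum_diff_set s d S'"
proof
  show "sum_diff_set s d (S \<inter> S') \<subseteq> sum_diff_set s d S \<inter> sum_diff_set s d S'"
    by (simp add: sum_diff_set_mono)
  show "sum_diff_set s d S \<inter> sum_diff_set s d S' \<subseteq> sum_diff_set s d (S \<inter> S')"
  proof
    fix g assume "g \<in> sum_diff_set s d S \<inter> sum_diff_set s d S'"
    then obtain u u' where u: "\<forall>i<s+d. u i \<in> S" "g = (\<Sum>i<s+d. sg s i * u i)"
      and u': "\<forall>i<s+d. u' i \<in> S'" "g = (\<Sum>i<s+d. sg s i * u' i)"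
      unfolding Int_iff mem_sum_diff_set_iff by blast
    \<comment> \<open>The two moduli are indexed by booleans: \<open>True\<close> stands for
      \<open>m\<close> and \<open>u\<close>, \<open>False\<close> for \<open>m'\<close> and
      \<open>u'\<close>.\<close>
    have "\<exists>n. (\<Sum>i<s+d. sg s i * n i) = g \<and> (\<forall>i<s+d. \<forall>a\<in>{True,False}.
            [n i = (if a then u else u') i] (mod int (if a then m else m')))"
      by (rule signed_sum_local_global)
        (use assms u(2) u'(2) in \<open>auto simp: coprime_commute\<close>)
    then obtain n where n: "(\<Sum>i<s+d. sg s i * n i) = g"
      "\<And>i a. i < s+d \<Longrightarrow> a \<in> {True,False} \<Longrightarrow>
         [n i = (if a then u else u') i] (mod int (if a then m else m'))"
      by blast
    have "n i \<in> S \<inter> S'" if "i < s + d" for i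
    proof -
      have "[u i = n i] (mod int m)" "[u' i = n i] (mod int m')"
        using n(2)[OF that, of True] n(2)[OF that, of False] by (simp_all add: cong_sym)
      then show ?thesis
        using periodicD[OF S(1)] periodicD[OF S'(1)] u(1) u'(1) that by blast
    qed
    with n(1) show "g \<in> sum_diff_set s d (S \<inter> S')"
      unfolding mem_sum_diff_set_iff by blast
  qed
qed

lemma periodic_Int:
  assumes "periodic m S" "periodic m' S'"
  shows "periodic (m * m') (S \<inter> S')"
  unfolding periodic_def
proof (intro allI impI)
  fix a b assume ab: "[a = b] (mod int (m * m'))" and "a \<in> S \<inter> S'"
  moreover have "[a = b] (mod int m)" "[a = b] (mod int m')"
    by (rule cong_dvd_modulus[OF ab]; simp)+
  ultimately show "b \<in> S \<inter> S'"
    using periodicD[OF assms(1)] periodicD[OF assms(2)] by blast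
qed

section \<open>Counting residues\<close>

definition residues_count :: "nat \<Rightarrow> int set \<Rightarrow> nat" where
  "residues_count m S = card (S \<inter> {0..<int m})"

lemma residues_count_le: "residues_count m S \<le> m"
  unfolding residues_count_def
  using card_mono[of "{0..<int m}" "S \<inter> {0..<int m}"] by simp

lemma residues_count_UNIV: "residues_count m UNIV = m"
  by (simp add: residues_count_def)

lemma residues_count_pos:
  assumes "periodic m S" "m > 0" "S \<noteq> {}"
  shows "residues_count m S > 0"
proof -
  obtain a where "a \<in> S" using assms by blast
  then have "a mod int m \<in> S \<inter> {0..<int m}"
    using assms periodic_mod by simp
  then show ?thesis
    unfolding residues_count_def by (subst card_gt_0_iff) auto
qed

text \<open>A residue modulo \<open>m * m'\<close> is a pair of residues; membership in
  \<open>S\<close> depends only on the first entry and membership in \<open>S'\<close> only on the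
  second.\<close>

lemma residues_count_Int:
  assumes S: "periodic m S" "m > 0" and S': "periodic m' S'" "m' > 0" and cop: "coprime m m'"
  shows "residues_count (m * m') (S \<inter> S') = residues_count m S * residues_count m' S'"
proof -
  let ?f = "\<lambda>n. (n mod int m, n mod int m')"
  have "bij_betw ?f (S \<inter> S' \<inter> {0..<int (m * m')}) ((S \<inter> {0..<int m}) \<times> (S' \<inter> {0..<int m'}))"
    unfolding bij_betw_def
  proof
    show "inj_on ?f (S \<inter> S' \<inter> {0..<int (m * m')})"
    proof (rule inj_onI)
      fix a b assume a: "a \<in> S \<inter> S' \<inter> {0..<int (m * m')}" and b: "b \<in> S \<inter> S' \<inter> {0..<int (m * m')}"
        and "?f a = ?f b"
      then have "[a = b] (mod int m)" "[a = b] (mod int m')"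
        by (auto simp: cong_def)
      then have "[a = b] (mod int m * int m')"
        using cop by (intro coprime_cong_mult) auto
      then show "a = b"
        using a b by (simp add: cong_def)
    qed
    show "?f ` (S \<inter> S' \<inter> {0..<int (m * m')}) = (S \<inter> {0..<int m}) \<times> (S' \<inter> {0..<int m'})"
    proof (intro equalityI subsetI)
      fix p assume "p \<in> ?f ` (S \<inter> S' \<inter> {0..<int (m * m')})"
      then show "p \<in> (S \<inter> {0..<int m}) \<times> (S' \<inter> {0..<int m'})"
        using S S' by (auto simp: periodic_mod)
    next
      fix p assume "p \<in> (S \<inter> {0..<int m}) \<times> (S' \<inter> {0..<int m'})"
      then obtain a b where p: "p = (a, b)" and a: "a \<in> S" "0 \<le> a" "a < int m"
        and b: "b \<in> S'" "0 \<le> b" "b < int m'" by auto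
      have "coprime (int m) (int m')" using cop by simp
      then obtain x where x: "[x = a] (mod int m)" "[x = b] (mod int m')"
        using binary_chinese_remainder_int by blast
      let ?x = "x mod int (m * m')"
      have "[?x = x] (mod int m * int m')"
        by (simp add: cong_def)
      then have "[?x = x] (mod int m)" "[?x = x] (mod int m')"
        using cong_modulus_mult cong_modulus_mult[of ?x x "int m'" "int m"] by (simp_all only: mult.commute)
      then have y: "[?x = a] (mod int m)" "[?x = b] (mod int m')"
        using x cong_trans by blast+
      have "?x \<in> S" "?x \<in> S'"
        using y a b periodicD[OF S(1)] periodicD[OF S'(1)] cong_sym by blast+
      moreover have "?f ?x = p"
        using y a b p by (simp add: cong_def)
      moreover have "?x \<in> {0..<int (m * m')}"
        using S S' by simp
      ultimately show "p \<in> ?f ` (S \<inter> S' \<inter> {0..<int (m * m')})"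
        by (metis (no_types, lifting) IntI imageI)
    qed
  qed
  then show ?thesis
    unfolding residues_count_def by (simp add: bij_betw_same_card card_cartesian_product)
qed

section \<open>Truncating a periodic set to an interval\<close>

text \<open>Greedy filling: one summand takes \<open>min t L\<close> and the others share the rest.
  It distributes multiples of the period over the summands.\<close>

lemma bounded_summands:
  assumes "0 \<le> t" "t \<le> int s * L"
  shows "\<exists>f. (\<forall>i<s. 0 \<le> f i \<and> f i \<le> L) \<and> (\<Sum>i<s. f i) = t"
  using assms
proof (induction s arbitrary: t)
  case 0
  then show ?case by simp
next
  case (Suc s)
  have L: "0 \<le> L"
    using Suc.prems by (metis of_nat_0_le_iff of_nat_Suc mult_neg_pos not_le 
        of_nat_0_less_iff order_trans zero_less_Suc mult.commute)
  have "0 \<le> t - min t L" "t - min t L \<le> int s * L"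
    using Suc.prems L by (auto simp: algebra_simps min_def)
  then obtain f where f: "\<forall>i<s. 0 \<le> f i \<and> f i \<le> L" "(\<Sum>i<s. f i) = t - min t L"
    using Suc.IH by blast
  let ?f = "f(s := min t L)"
  have "\<forall>i<Suc s. 0 \<le> ?f i \<and> ?f i \<le> L"
    using f(1) L Suc.prems by (auto simp: less_Suc_eq)
  moreover have "(\<Sum>i<Suc s. ?f i) = t"
    using f(2) by simp
  ultimately show ?case by blast
qed

text \<open>Each residue of the sum-difference set has a base point \<open>b\<close> built from
  least residues. Raising single summands by up to \<open>L\<close> periods moves the sum through
  \<open>b + m * t\<close> for all \<open>t\<close> from \<open>- d * L\<close> to
  \<open>s * L\<close>, and distinct residues give disjoint progressions.\<close>

lemma card_sum_diff_set_truncation_ge: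
  assumes S: "periodic m S" "m > 0"
  shows "residues_count m (sum_diff_set s d S) * ((s + d) * L + 1)
         \<le> card (sum_diff_set s d (S \<inter> {0..<int (m * (L + 1))}))"
proof -
  let ?A = "S \<inter> {0..<int (m * (L + 1))}"
  let ?G = "sum_diff_set s d S \<inter> {0..<int m}"
  let ?T = "{- int (d * L)..int (s * L)}"
  have "\<exists>b. [b = g] (mod int m) \<and> (\<forall>t\<in>?T. b + int m * t \<in> sum_diff_set s d ?A)" if gG: "g \<in> ?G" for g
  proof -
    obtain u v where g: "g = (\<Sum>i<s. u i) - (\<Sum>j<d. v j)"
      and u: "\<forall>i<s. u i \<in> S" and v: "\<forall>j<d. v j \<in> S"
      using gG unfolding sum_diff_set_def by blast
    define b where "b = (\<Sum>i<s. u i mod int m) - (\<Sum>j<d. v j mod int m)"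
    have "[b = g] (mod int m)"
      unfolding b_def g by (intro cong_diff cong_sum) (simp_all add: cong_def)
    moreover have "b + int m * t \<in> sum_diff_set s d ?A" if t: "t \<in> ?T" for t
    proof -
      \<comment> \<open>A positive \<open>t\<close> is spread over the plus summands, a negative one
        over the minus summands.\<close>
      have "0 \<le> max 0 t" "max 0 t \<le> int s * int L" using t by auto
      then obtain f where f: "\<forall>i<s. 0 \<le> f i \<and> f i \<le> int L" "(\<Sum>i<s. f i) = max 0 t"
        using bounded_summands by blast
      have "0 \<le> max 0 (-t)" "max 0 (-t) \<le> int d * int L" using t by auto
      then obtain h where h: "\<forall>i<d. 0 \<le> h i \<and> h i \<le> int L" "(\<Sum>i<d. h i) = max 0 (-t)"
        using bounded_summands by blast
      have mem: "a mod int m + int m * c \<in> ?A" if "a \<in> S" "0 \<le> c" "c \<le> int L" for a c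
      proof -
        have "[a = a mod int m + int m * c] (mod int m)"
          by (simp add: cong_def)
        then have "a mod int m + int m * c \<in> S"
          using periodicD S that by blast
        moreover have "a mod int m < int m" "int m * c \<le> int m * int L"
          using S that by (auto intro: mult_left_mono)
        moreover have "0 \<le> a mod int m + int m * c"
          using S that by simp
        ultimately show ?thesis by (auto simp: algebra_simps)
      qed
      have "b + int m * t = (\<Sum>i<s. u i mod int m + int m * f i) - (\<Sum>j<d. v j mod int m + int m * h j)"
        unfolding b_def sum.distrib sum_distrib_left[symmetric] f(2) h(2) by (auto simp: algebra_simps max_def)
      moreover have "\<forall>i<s. u i mod int m + int m * f i \<in> ?A" "\<forall>j<d. v j mod int m + int m * h j \<in> ?A"
        using mem u v f h by blast+
      ultimately show ?thesis
        unfolding sum_diff_set_def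
        by (intro CollectI exI[of _ "\<lambda>i. u i mod int m + int m * f i"]
            exI[of _ "\<lambda>j. v j mod int m + int m * h j"]) blast
    qed
    ultimately show ?thesis by blast
  qed
  then obtain b where b: "\<And>g. g \<in> ?G \<Longrightarrow> [b g = g] (mod int m)"
    "\<And>g t. g \<in> ?G \<Longrightarrow> t \<in> ?T \<Longrightarrow> b g + int m * t \<in> sum_diff_set s d ?A"
    by metis
  let ?f = "\<lambda>(g, t). b g + int m * t"
  have inj: "inj_on ?f (?G \<times> ?T)"
  proof (rule inj_onI, clarify)
    fix g t g' t' assume *: "g \<in> sum_diff_set s d S" "g \<in> {0..<int m}" "g' \<in> sum_diff_set s d S" "g' \<in> {0..<int m}"
      and eq: "b g + int m * t = b g' + int m * t'"
    have "[b g = b g + int m * t] (mod int m)" "[b g' + int m * t' = b g'] (mod int m)"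
      by (simp_all add: cong_def)
    then have "[g = g'] (mod int m)"
      using b(1) * eq by (metis IntI cong_sym cong_trans)
    then have "g = g'" using * by (simp add: cong_def)
    then show "g = g' \<and> t = t'" using eq S by simp
  qed
  \<comment> \<open>Finiteness matters for the lower bound, since \<open>card\<close> of an infinite
    set is 0. The sums are images of functions on \<open>{..<s+d}\<close> with values in a finite
    set.\<close>
  have "finite (sum_diff_set s d ?A)"
  proof -
    have "sum_diff_set s d ?A \<subseteq> (\<lambda>u. \<Sum>i<s+d. sg s i * u i) ` ({..<s+d} \<rightarrow>\<^sub>E ?A)"
    proof
      fix g assume "g \<in> sum_diff_set s d ?A"
      then obtain u where u: "\<forall>i<s+d. u i \<in> ?A" "g = (\<Sum>i<s+d. sg s i * u i)"
        unfolding mem_sum_diff_set_iff by blast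
      have "g = (\<Sum>i<s+d. sg s i * restrict u {..<s+d} i)"
        using u(2) by simp
      moreover have "restrict u {..<s+d} \<in> {..<s+d} \<rightarrow>\<^sub>E ?A"
        using u(1) by auto
      ultimately show "g \<in> (\<lambda>u. \<Sum>i<s+d. sg s i * u i) ` ({..<s+d} \<rightarrow>\<^sub>E ?A)"
        by blast
    qed
    then show ?thesis by (rule finite_subset) (intro finite_imageI finite_PiE; simp)
  qed
  then have "card (?f ` (?G \<times> ?T)) \<le> card (sum_diff_set s d ?A)"
    using b(2) by (intro card_mono) auto
  moreover have "card (?f ` (?G \<times> ?T)) = card ?G * ((s + d) * L + 1)"
    by (subst card_image[OF inj]) (simp add: card_cartesian_product nat_add_distrib algebra_simps flip: of_nat_mult of_nat_add)
  ultimately show ?thesis unfolding residues_count_def by simp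
qed

text \<open>An integer is determined by its remainder and quotient modulo \<open>m\<close>. The
  remainder is one of the counted residues, and the size of the summands confines the quotient to
  \<open>(s + d) * T + 1\<close> values.\<close>

lemma card_sum_diff_set_truncation_le:
  assumes S: "periodic m S" "m > 0" and sd: "s + d > 0"
  shows "card (sum_diff_set s d (S \<inter> {0..<int (m * T)}))
         \<le> residues_count m (sum_diff_set s d S) * ((s + d) * T + 1)"
proof -
  let ?A = "S \<inter> {0..<int (m * T)}"
  let ?G = "sum_diff_set s d S \<inter> {0..<int m}"
  let ?I = "{- int (d * T)..int (s * T)}"
  let ?f = "\<lambda>n. (n mod int m, n div int m)"
  have inj: "inj_on ?f (sum_diff_set s d ?A)"
    by (rule inj_onI) (metis Pair_inject mult_div_mod_eq)
  have sub: "?f ` sum_diff_set s d ?A \<subseteq> ?G \<times> ?I"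
  proof
    fix p assume "p \<in> ?f ` sum_diff_set s d ?A"
    then obtain g where p: "p = ?f g" and g: "g \<in> sum_diff_set s d ?A" by blast
    obtain u v where guv: "g = (\<Sum>i<s. u i) - (\<Sum>j<d. v j)"
      and u: "\<forall>i<s. u i \<in> ?A" and v: "\<forall>j<d. v j \<in> ?A"
      using g unfolding sum_diff_set_def by blast
    have "(\<Sum>i<s. u i) \<le> (\<Sum>i<s. int (m * T))" "(\<Sum>i<d. v i) \<le> (\<Sum>i<d. int (m * T))"
      using u v by (force intro!: sum_mono)+
    moreover have "(\<Sum>i<s. u i) \<ge> 0" "(\<Sum>i<d. v i) \<ge> 0"
      using u v by (force intro!: sum_nonneg)+
    ultimately have *: "g \<le> int m * int (s * T)" "int m * (- int (d * T)) \<le> g"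
      unfolding guv by (simp_all add: algebra_simps)
    have "g div int m \<le> int m * int (s * T) div int m" "int m * (- int (d * T)) div int m \<le> g div int m"
      by (rule zdiv_mono1; use * S in simp)+
    moreover have "int m * (- int (d * T)) div int m = - int (d * T)"
      using S by (intro nonzero_mult_div_cancel_left) simp
    ultimately have "g div int m \<in> ?I" using S by simp
    moreover have "g mod int m \<in> sum_diff_set s d S"
      using g periodic_mod[OF periodic_sum_diff_set[OF S sd]] sum_diff_set_mono[of ?A S] by blast
    ultimately show "p \<in> ?G \<times> ?I"
      using S p by simp
  qed
  have "card (sum_diff_set s d ?A) = card (?f ` sum_diff_set s d ?A)"
    by (rule card_image[OF inj, symmetric])
  also have "\<dots> \<le> card (?G \<times> ?I)"
    by (rule card_mono[OF _ sub]) simp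
  also have "\<dots> = card ?G * ((s + d) * T + 1)"
    by (simp add: card_cartesian_product nat_add_distrib algebra_simps flip: of_nat_mult of_nat_add)
  finally show ?thesis unfolding residues_count_def .
qed

section \<open>Large primes, densities of multiples and linear congruences\<close>

lemma ex_large_prime_set: "\<exists>P. finite P \<and> card P = n \<and> (\<forall>p\<in>P. prime p \<and> (b::nat) < p)"
proof -
  have "infinite {p. prime p \<and> b < p}"
  proof -
    have "{p. prime p \<and> b < p} = {p. prime p} - {..b}" by auto
    then show ?thesis using Diff_infinite_finite[OF finite_atMost primes_infinite] by simp
  qed
  then show ?thesis
    using infinite_arbitrarily_large[of "{p. prime p \<and> b < p}" n] by blast
qed

lemma card_multiples_int:
  assumes "q dvd m" "q > 0"
  shows "card ({n. int q dvd n} \<inter> {0..<int m}) \<le> m div q"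
proof -
  have "{n. int q dvd n} \<inter> {0..<int m} \<subseteq> (\<lambda>k. int (q * k)) ` {..<m div q}"
  proof
    fix n assume n: "n \<in> {n. int q dvd n} \<inter> {0..<int m}"
    then obtain k where k: "n = int q * k" by auto
    have k0: "0 \<le> k" using n k assms by (simp add: zero_le_mult_iff)
    obtain r where r: "m = q * r" using assms by auto
    have "k < int r" using n k r assms by simp
    then have "nat k < m div q" using k0 r assms by (simp add: nat_less_iff)
    moreover have "n = int (q * nat k)" using k k0 by simp
    ultimately show "n \<in> (\<lambda>k. int (q * k)) ` {..<m div q}" by blast
  qed
  then have "card ({n. int q dvd n} \<inter> {0..<int m}) \<le> card ((\<lambda>k. int (q * k)) ` {..<m div q})"
    by (intro card_mono) auto
  also have "\<dots> \<le> m div q"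
    using card_image_le[of "{..<m div q}" "\<lambda>k. int (q * k)"] by simp
  finally show ?thesis .
qed

text \<open>Union bound: multiples of \<open>q\<close> occupy a share \<open>1 / q\<close> of the
  residues, and each \<open>q\<close> exceeds \<open>B * card Q\<close>, so all shares together stay
  below \<open>1 / B\<close>.\<close>

lemma residues_count_multiples:
  assumes fin: "finite Q" and Q: "\<And>q. q \<in> Q \<Longrightarrow> q dvd m \<and> B * card Q < q"
    and sub: "X \<subseteq> {n. \<exists>q\<in>Q. int q dvd n}" and m: "m > 0"
  shows "B * residues_count m X < m"
proof (cases "Q = {} \<or> B = 0")
  case True
  then show ?thesis using sub m by (auto simp: residues_count_def)
next
  case False
  then have Q0: "card Q > 0" and B: "B > 0" using fin by (auto simp: card_gt_0_iff)
  have q0: "q > 0" if "q \<in> Q" for q using Q[OF that] by simp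
  have "residues_count m X \<le> card (\<Union>q\<in>Q. {n. int q dvd n} \<inter> {0..<int m})"
    unfolding residues_count_def using sub fin by (intro card_mono) auto
  also have "\<dots> \<le> (\<Sum>q\<in>Q. card ({n. int q dvd n} \<inter> {0..<int m}))"
    using fin by (rule card_UN_le)
  also have "\<dots> \<le> (\<Sum>q\<in>Q. m div q)"
    using Q q0 by (intro sum_mono card_multiples_int) auto
  finally have *: "residues_count m X \<le> (\<Sum>q\<in>Q. m div q)" .
  have "B * card Q * (m div q) < m" if "q \<in> Q" for q
  proof -
    obtain r where r: "m = q * r" using Q \<open>q \<in> Q\<close> by blast
    then show ?thesis using Q[OF that] m by simp
  qed
  then have "(\<Sum>q\<in>Q. B * card Q * (m div q)) < (\<Sum>q\<in>Q. m)"
    using fin Q0 by (intro sum_strict_mono) auto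
  then have "card Q * (B * (\<Sum>q\<in>Q. m div q)) < card Q * m"
    by (simp add: sum_distrib_left mult_ac)
  then have "B * (\<Sum>q\<in>Q. m div q) < m" using Q0 by simp
  with * show ?thesis
    by (meson le_less_trans mult_le_mono2)
qed

lemma sum_sg_const: "(\<Sum>i<s+d. sg s i) = int s - int d"
  using sum_sg[where s = s and d = d and u = "\<lambda>_. 1"] by simp

text \<open>Evaluates signed sums in which a single summand, of either sign, deviates from a common
  value; the sign of that summand decides the direction of the correction.\<close>

lemma sum_sg_perturbed:
  assumes "i0 < s + d"
  shows "(\<Sum>i<s+d. sg s i * (if i = i0 then a else b)) = (int s - int d) * b + sg s i0 * (a - b)"
proof -
  have "(\<Sum>i<s+d. sg s i * (if i = i0 then a else b))
      = (\<Sum>i<s+d. sg s i * b + (if i = i0 then sg s i0 * (a - b) else 0))"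
    by (intro sum.cong) (auto simp: algebra_simps)
  also have "\<dots> = (int s - int d) * b + sg s i0 * (a - b)"
    using assms by (simp add: sum.distrib sum_sg_const flip: sum_distrib_right)
  finally show ?thesis .
qed

lemma coprime_prime_bounded:
  assumes "prime p" "a \<noteq> 0" "\<bar>a\<bar> < int p"
  shows "coprime a (int p)"
proof -
  have "\<not> int p dvd a"
    using assms zdvd_not_zless[of "\<bar>a\<bar>" "int p"] by simp
  then show ?thesis
    using assms by (metis prime_imp_coprime coprime_commute prime_nat_int_transfer)
qed

lemma linear_cong_solvable:
  assumes "prime p" "a \<noteq> 0" "\<bar>a\<bar> < int p"
  shows "\<exists>r. [a * r = g] (mod int p)"
proof -
  obtain r where "[a * r = 1] (mod int p)"
    using cong_solve_coprime_int[OF coprime_prime_bounded[OF assms]] by blast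
  then have "[a * r * g = 1 * g] (mod int p)" by (rule cong_scalar_right)
  then show ?thesis by (intro exI[of _ "r * g"]) (simp add: mult.assoc)
qed

section \<open>The periodic set for a single level\<close>

text \<open>Pieces are indexed by pairs. For \<open>r < N\<close> the pieces \<open>(r, 0), \<dots>, (r, j - 1)\<close> form a family,
  and \<open>(N, 0), \<dots>, (N, j)\<close> are background pieces. Each set \<open>K\<close> of at most \<open>j\<close> pieces that is not
  a family gets its own prime, which divides all elements of the pieces in \<open>K\<close>: only a family
  (or more than \<open>j\<close> pieces) can reach every residue. Within a family the pieces are congruent to
  \<open>r\<close>, except that piece \<open>0\<close> is congruent to \<open>(1 + \<delta>) r\<close> modulo \<open>p1\<close> and to \<open>(1 - \<delta>) r\<close> modulo \<open>p2\<close>.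
  A signed sum of a family with \<open>s\<close> plus and \<open>t\<close> minus signs is then \<open>(s - t \<plusminus> \<delta>) r\<close> modulo \<open>p1\<close>
  and \<open>(s - t \<mp> \<delta>) r\<close> modulo \<open>p2\<close>, and one of these vanishes for all \<open>r\<close> exactly when
  \<open>\<bar>s - t\<bar> = \<bar>\<delta>\<bar>\<close>.\<close>

lemma level_set_exists:
  fixes w z B B' :: nat
  assumes j: "w + z > 0" and B': "B' > 0"
  shows "\<exists>m S. m > 0 \<and> coprime m B' \<and> periodic m S \<and> 0 \<in> S \<and>
     (\<forall>x y. x + y = w + z \<longrightarrow> {x, y} \<noteq> {w, z} \<longrightarrow> sum_diff_set x y S = UNIV) \<and>
     (\<forall>x y. x + y > w + z \<longrightarrow> sum_diff_set x y S = UNIV) \<and>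
     B * residues_count m (sum_diff_set w z S) < m"
proof -
  define j where "j = w + z"
  define \<delta> where "\<delta> = int w - int z"
  have j0: "j > 0" using j by (simp add: j_def)
  \<comment> \<open>\<open>4 * B\<close> makes multiples of \<open>p1\<close> and \<open>p2\<close>
    rare, \<open>2 * j\<close> makes the nonzero coefficients met below invertible, and
    \<open>B'\<close> ensures coprimality with \<open>B'\<close>.\<close>
  obtain p1 where p1: "prime p1" "4 * B + 2 * j + B' < p1"
    using bigger_prime by blast
  obtain p2 where p2: "prime p2" "p1 < p2"
    using bigger_prime by blast
  \<comment> \<open>The numbers \<open>r < N\<close> realise every pair of residues modulo
    \<open>p1\<close> and \<open>p2\<close>.\<close>
  define N where "N = p1 * p2"
  define I where "I = {..<N} \<times> {..<j} \<union> {N} \<times> {..j}"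
  define \<K> where "\<K> = {K. K \<subseteq> I \<and> card K \<le> j \<and> (\<forall>r<N. K \<noteq> {r} \<times> {..<j})}"
  have finI: "finite I" unfolding I_def by blast
  have "\<K> \<subseteq> Pow I" unfolding \<K>_def by blast
  then have fin\<K>: "finite \<K>" using finI finite_subset by blast
  \<comment> \<open>One prime for each member of \<open>\<K>\<close>. Being above \<open>p2\<close>
    keeps them distinct from \<open>p1\<close> and \<open>p2\<close>; the other term keeps their
    multiples rare.\<close>
  obtain P where P: "finite P" "card P = card \<K>" and P_prime: "\<And>p. p \<in> P \<Longrightarrow> prime p"
    and P_gt: "\<And>p. p \<in> P \<Longrightarrow> p2 + 2 * B * card \<K> < p"
    using ex_large_prime_set[of "card \<K>" "p2 + 2 * B * card \<K>"] by blast
  obtain h where h: "bij_betw h P \<K>"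
    using finite_same_card_bij P fin\<K> by blast
  define res1 where "res1 \<alpha> = (if snd \<alpha> = 0 then (1 + \<delta>) * int (fst \<alpha>) else int (fst \<alpha>))" for \<alpha> :: "nat \<times> nat"
  define res2 where "res2 \<alpha> = (if snd \<alpha> = 0 then (1 - \<delta>) * int (fst \<alpha>) else int (fst \<alpha>))" for \<alpha> :: "nat \<times> nat"
  \<comment> \<open>Background pieces, with first index \<open>N\<close>, are unrestricted modulo
    \<open>p1\<close> and \<open>p2\<close>; in particular they contain 0.\<close>
  define piece where "piece \<alpha> = {n. (fst \<alpha> \<noteq> N \<longrightarrow> [n = res1 \<alpha>] (mod int p1) \<and> [n = res2 \<alpha>] (mod int p2))
      \<and> (\<forall>p\<in>P. \<alpha> \<in> h p \<longrightarrow> int p dvd n)}" for \<alpha>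
  define S where "S = (\<Union>\<alpha>\<in>I. piece \<alpha>)"
  define Q where "Q = insert p1 (insert p2 P)"
  define m where "m = \<Prod>Q"
  have P_gt2: "p2 < p" if "p \<in> P" for p
    using P_gt[OF that] by simp
  have p12: "p1 \<noteq> p2" "p1 \<notin> P" "p2 \<notin> P"
    using p2(2) P_gt2 less_asym by blast+
  have Q_prime: "prime q" if "q \<in> Q" for q
    using that p1 p2 P_prime unfolding Q_def by blast
  have finQ: "finite Q" unfolding Q_def using P by blast
  have Q_gt: "q > B'" if "q \<in> Q" for q
    using that p1(2) p2(2) P_gt2[of q] unfolding Q_def by auto
  have Q_dvd: "q dvd m" if "q \<in> Q" for q
    unfolding m_def using that finQ by (rule dvd_prodI[rotated])
  have m0: "m > 0"
    unfolding m_def using Q_prime by (intro prod_pos) (simp add: prime_gt_0_nat)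
  have copB': "coprime m B'"
    unfolding m_def
  proof (rule prod_coprime_left)
    fix q assume q: "q \<in> Q"
    then have "\<not> q dvd B'" using Q_gt[OF q] B' by (auto dest: dvd_imp_le)
    then show "coprime q B'" using Q_prime[OF q] prime_imp_coprime by blast
  qed
  have per: "periodic m S"
    unfolding periodic_def
  proof (intro allI impI)
    fix a b assume ab: "[a = b] (mod int m)" and "a \<in> S"
    then obtain \<alpha> where \<alpha>: "\<alpha> \<in> I" "a \<in> piece \<alpha>" unfolding S_def by blast
    have ab': "[b = a] (mod int q)" if "q \<in> Q" for q
      using ab Q_dvd[OF that] cong_dvd_modulus cong_sym int_dvd_int_iff by blast
    have "b \<in> piece \<alpha>"
      unfolding piece_def
    proof (intro CollectI conjI impI ballI)
      show "[b = res1 \<alpha>] (mod int p1)" if "fst \<alpha> \<noteq> N"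
        using \<alpha>(2) that ab'[of p1] cong_trans unfolding piece_def Q_def by blast
      show "[b = res2 \<alpha>] (mod int p2)" if "fst \<alpha> \<noteq> N"
        using \<alpha>(2) that ab'[of p2] cong_trans unfolding piece_def Q_def by blast
      show "int p dvd b" if "p \<in> P" "\<alpha> \<in> h p" for p
        using \<alpha>(2) that ab'[of p] cong_dvd_iff unfolding piece_def Q_def by blast
    qed
    then show "b \<in> S" using \<alpha>(1) unfolding S_def by blast
  qed
  have zero: "0 \<in> S"
  proof -
    have "0 \<in> piece (N, 0)" unfolding piece_def by simp
    then show ?thesis unfolding S_def I_def by blast
  qed
  \<comment> \<open>If no member of \<open>\<K>\<close> contains all chosen pieces, only
    \<open>p1\<close> and \<open>p2\<close> can obstruct \<open>g\<close>: modulo each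
    \<open>p\<close> in \<open>P\<close>, some summand \<open>e p\<close> lies in a piece outside
    \<open>h p\<close> and may absorb \<open>g\<close>, all others being 0.\<close>
  have in_sum_diff_set: "g \<in> sum_diff_set x y S"
    if xy: "x + y > 0" and \<alpha>: "\<And>i. i < x + y \<Longrightarrow> \<alpha> i \<in> I"
      and escape: "\<And>K. K \<in> \<K> \<Longrightarrow> \<exists>i<x + y. \<alpha> i \<notin> K"
      and g1: "[(\<Sum>i<x+y. sg x i * a1 i) = g] (mod int p1)"
      and g2: "[(\<Sum>i<x+y. sg x i * a2 i) = g] (mod int p2)"
      and res: "\<And>i. i < x + y \<Longrightarrow> fst (\<alpha> i) \<noteq> N \<Longrightarrow> a1 i = res1 (\<alpha> i) \<and> a2 i = res2 (\<alpha> i)"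
    for x y g \<alpha> a1 a2
  proof -
    have "\<exists>i<x + y. \<alpha> i \<notin> h p" if "p \<in> P" for p
      using escape h that by (auto simp: bij_betw_def)
    then obtain e where e: "\<And>p. p \<in> P \<Longrightarrow> e p < x + y \<and> \<alpha> (e p) \<notin> h p" by metis
    define c where "c q i = (if q = p1 then a1 i else if q = p2 then a2 i
        else if i = e q then sg x i * g else 0)" for q i
    have "\<exists>n. (\<Sum>i<x+y. sg x i * n i) = g \<and> (\<forall>i<x+y. \<forall>q\<in>Q. [n i = c q i] (mod int q))"
    proof (rule signed_sum_local_global[OF finQ _ _ xy])
      show "coprime a b" if "a \<in> Q" "b \<in> Q" "a \<noteq> b" for a b
        using that Q_prime primes_coprime by blast
      show "0 < q" if "q \<in> Q" for q
        using Q_prime[OF that] prime_gt_0_nat by blast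
      show "[(\<Sum>i<x+y. sg x i * c q i) = g] (mod int q)" if q: "q \<in> Q" for q
      proof -
        consider "q = p1" | "q = p2" | "q \<in> P" using q unfolding Q_def by blast
        then show ?thesis
        proof cases
          case 1
          then show ?thesis using g1 by (simp add: c_def)
        next
          case 2
          then show ?thesis using g2 p12 by (simp add: c_def)
        next
          case 3
          then have "q \<noteq> p1" "q \<noteq> p2" using p12 by auto
          then have "(\<Sum>i<x+y. sg x i * c q i) = (\<Sum>i<x+y. if i = e q then g else 0)"
            by (intro sum.cong) (auto simp: c_def)
          also have "\<dots> = g" using e[OF 3] by simp
          finally show ?thesis by simp
        qed
      qed
    qed
    then obtain n where n: "(\<Sum>i<x+y. sg x i * n i) = g"
      "\<And>i q. i < x+y \<Longrightarrow> q \<in> Q \<Longrightarrow> [n i = c q i] (mod int q)" by blast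
    have "n i \<in> piece (\<alpha> i)" if i: "i < x + y" for i
      unfolding piece_def
    proof (intro CollectI conjI impI ballI)
      show "[n i = res1 (\<alpha> i)] (mod int p1)" if "fst (\<alpha> i) \<noteq> N"
        using n(2)[OF i, of p1] res[OF i that] unfolding Q_def c_def by simp
      show "[n i = res2 (\<alpha> i)] (mod int p2)" if "fst (\<alpha> i) \<noteq> N"
        using n(2)[OF i, of p2] res[OF i that] p12 unfolding Q_def c_def by simp
      show "int p dvd n i" if p: "p \<in> P" "\<alpha> i \<in> h p" for p
      proof -
        have "p \<noteq> p1" "p \<noteq> p2" "i \<noteq> e p" using p p12 e[OF p(1)] by auto
        then have "[n i = 0] (mod int p)"
          using n(2)[OF i, of p] p unfolding Q_def c_def by simp
        then show ?thesis by (simp add: cong_0_iff)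
      qed
    qed
    then have "\<forall>i<x + y. n i \<in> S" using \<alpha> unfolding S_def by blast
    then show ?thesis unfolding mem_sum_diff_set_iff using n(1) by blast
  qed
  have full_above: "sum_diff_set x y S = UNIV" if xy: "x + y > w + z" for x y
  proof -
    have "g \<in> sum_diff_set x y S" for g
    \<comment> \<open>The summands run through all \<open>j + 1\<close> background pieces, too many
      for a member of \<open>\<K>\<close>; modulo \<open>p1\<close> and \<open>p2\<close>, summand 0
      carries all of \<open>g\<close>.\<close>
    proof (rule in_sum_diff_set[where \<alpha> = "\<lambda>i. (N, min i j)" and ?a1.0 = "\<lambda>i. if i = 0 then sg x 0 * g else 0"
            and ?a2.0 = "\<lambda>i. if i = 0 then sg x 0 * g else 0"])
      have "(\<Sum>i<x+y. sg x i * (if i = 0 then sg x 0 * g else 0)) = (\<Sum>i<x+y. if i = 0 then g else 0)"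
        by (intro sum.cong) auto
      also have "\<dots> = g" using xy by simp
      finally show "[(\<Sum>i<x+y. sg x i * (if i = 0 then sg x 0 * g else 0)) = g] (mod int p1)"
        "[(\<Sum>i<x+y. sg x i * (if i = 0 then sg x 0 * g else 0)) = g] (mod int p2)" by simp_all
      show "\<exists>i<x + y. (N, min i j) \<notin> K" if K: "K \<in> \<K>" for K
      proof (rule ccontr)
        assume "\<not> ?thesis"
        then have in_K: "(N, min i j) \<in> K" if "i < x + y" for i using that by blast
        have "{N} \<times> {..j} \<subseteq> K"
        proof
          fix \<beta> assume "\<beta> \<in> {N} \<times> {..j}"
          then show "\<beta> \<in> K" using in_K[of "snd \<beta>"] xy by (auto simp: j_def min_absorb1)
        qed
        moreover have "finite K" using K finI finite_subset unfolding \<K>_def by blast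
        ultimately have "Suc j \<le> card K"
          using card_mono[of K "{N} \<times> {..j}"] by (simp add: card_cartesian_product)
        then show False using K unfolding \<K>_def by simp
      qed
    qed (use xy in \<open>auto simp: I_def\<close>)
    then show ?thesis by blast
  qed
  have full_at: "sum_diff_set x y S = UNIV" if xy: "x + y = w + z" "{x, y} \<noteq> {w, z}" for x y
  proof -
    define e where "e = int x - int y"
    \<comment> \<open>With equal sums, a difference \<open>x - y\<close> equal to \<delta> or its
      negative would force equal unordered pairs.\<close>
    have ne: "e + \<delta> \<noteq> 0" "e - \<delta> \<noteq> 0" 
      using xy by (auto simp: e_def \<delta>_def doubleton_eq_iff)
    have "\<bar>e + \<delta>\<bar> \<le> int (2 * j)" "\<bar>e - \<delta>\<bar> \<le> int (2 * j)"
      using xy by (auto simp: e_def \<delta>_def j_def)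
    then have lt: "\<bar>e + \<delta>\<bar> < int p1" "\<bar>e - \<delta>\<bar> < int p1" "\<bar>e + \<delta>\<bar> < int p2" "\<bar>e - \<delta>\<bar> < int p2"
      using p1(2) p2(2) by linarith+
    \<comment> \<open>Summand 0 is assigned to the exceptional piece \<open>(r, 0)\<close>; its sign
      is negative when \<open>x = 0\<close>.\<close>
    define \<sigma> where "\<sigma> = sg x 0"
    have \<sigma>: "\<sigma> = 1 \<or> \<sigma> = -1" by (simp add: \<sigma>_def sg_def)
    have "g \<in> sum_diff_set x y S" for g
    proof -
      \<comment> \<open>The family is chosen to suit \<open>g\<close>: its signed sum is a nonzero
        coefficient times \<open>r\<close> modulo each of \<open>p1\<close> and \<open>p2\<close>,
        so \<open>r\<close> can be solved for separately and recombined below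
        \<open>N\<close>.\<close>
      obtain r1 where r1: "[(e + \<sigma> * \<delta>) * r1 = g] (mod int p1)"
        using linear_cong_solvable[OF p1(1), of "e + \<sigma> * \<delta>" g] \<sigma> ne lt by auto
      obtain r2 where r2: "[(e - \<sigma> * \<delta>) * r2 = g] (mod int p2)"
        using linear_cong_solvable[OF p2(1), of "e - \<sigma> * \<delta>" g] \<sigma> ne lt by auto
      have "coprime (int p1) (int p2)"
        using primes_coprime[OF p1(1) p2(1) p12(1)] by simp
      then obtain r' where r': "[r' = r1] (mod int p1)" "[r' = r2] (mod int p2)"
        using binary_chinese_remainder_int by blast
      have N0: "N > 0" using p1 p2 by (simp add: N_def prime_gt_0_nat)
      define r where "r = nat (r' mod int N)"
      have r_lt: "r < N" using N0 by (simp add: r_def nat_less_iff)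
      have r_int: "int r = r' mod int N" using N0 by (simp add: r_def)
      have "[int r = r'] (mod int N)" unfolding r_int by (simp add: cong_def)
      then have "[int r = r'] (mod int p1)" "[int r = r'] (mod int p2)"
        unfolding N_def of_nat_mult
        using cong_modulus_mult cong_modulus_mult[of _ _ "int p2" "int p1"] by (simp_all only: mult.commute)
      then have r: "[int r = r1] (mod int p1)" "[int r = r2] (mod int p2)"
        using r' cong_trans by blast+
      show ?thesis
      proof (rule in_sum_diff_set[where \<alpha> = "\<lambda>i. (r, i)" and ?a1.0 = "\<lambda>i. res1 (r, i)" and ?a2.0 = "\<lambda>i. res2 (r, i)"])
        show "x + y > 0" using xy j by simp
        have "(\<Sum>i<x+y. sg x i * res1 (r, i)) = (e + \<sigma> * \<delta>) * int r"
          unfolding res1_def fst_conv snd_conv using xy j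
          by (subst sum_sg_perturbed) (simp_all add: e_def \<sigma>_def algebra_simps)
        then show "[(\<Sum>i<x+y. sg x i * res1 (r, i)) = g] (mod int p1)"
          using cong_trans[OF cong_scalar_left[OF r(1)] r1] by simp
        have "(\<Sum>i<x+y. sg x i * res2 (r, i)) = (e - \<sigma> * \<delta>) * int r"
          unfolding res2_def fst_conv snd_conv using xy j
          by (subst sum_sg_perturbed) (simp_all add: e_def \<sigma>_def algebra_simps)
        then show "[(\<Sum>i<x+y. sg x i * res2 (r, i)) = g] (mod int p2)"
          using cong_trans[OF cong_scalar_left[OF r(2)] r2] by simp
        show "\<exists>i<x + y. (r, i) \<notin> K" if K: "K \<in> \<K>" for K
        proof (rule ccontr)
          assume "\<not> ?thesis"
          then have "{r} \<times> {..<j} \<subseteq> K" using xy by (auto simp: j_def)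
          moreover have "finite K" "card K \<le> j" using K finI finite_subset unfolding \<K>_def by blast+
          ultimately have "{r} \<times> {..<j} = K"
            by (intro card_seteq) (simp_all add: card_cartesian_product)
          then show False using K r_lt unfolding \<K>_def by blast
        qed
      qed (use xy r_lt in \<open>auto simp: I_def j_def\<close>)
    qed
    then show ?thesis by blast
  qed
  \<comment> \<open>The \<open>j\<close> summands use at most \<open>j\<close> pieces. Either these
    form a member of \<open>\<K>\<close>, whose prime divides \<open>g\<close>, or they form a
    family and \<open>p1\<close> or \<open>p2\<close> divides \<open>g\<close>.\<close>
  have sparse: "sum_diff_set w z S \<subseteq> {n. \<exists>q\<in>Q. int q dvd n}"
  proof
    fix g assume "g \<in> sum_diff_set w z S"
    then obtain u where u: "\<forall>i<w+z. u i \<in> S" and g: "g = (\<Sum>i<w+z. sg w i * u i)"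
      unfolding mem_sum_diff_set_iff by blast
    have "\<forall>i<w+z. \<exists>\<alpha>\<in>I. u i \<in> piece \<alpha>" using u unfolding S_def by blast
    then obtain \<alpha> where \<alpha>: "\<And>i. i < w+z \<Longrightarrow> \<alpha> i \<in> I" "\<And>i. i < w+z \<Longrightarrow> u i \<in> piece (\<alpha> i)"
      by metis
    define K where "K = \<alpha> ` {..<w+z}"
    show "g \<in> {n. \<exists>q\<in>Q. int q dvd n}"
    proof (cases "K \<in> \<K>")
      case True
      then obtain p where p: "p \<in> P" "h p = K" using h by (auto simp: bij_betw_def)
      have "int p dvd u i" if "i < w + z" for i
        using \<alpha>(2)[OF that] p that unfolding piece_def K_def by blast
      then have "int p dvd g" unfolding g by (intro dvd_sum) simp
      then show ?thesis using p(1) unfolding Q_def by blast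
    next
      case False
      have "card K \<le> j" unfolding K_def j_def using card_image_le[of "{..<w+z}" \<alpha>] by simp
      moreover have "K \<subseteq> I" using \<alpha>(1) unfolding K_def by blast
      ultimately obtain r where r: "r < N" "K = {r} \<times> {..<j}"
        using False unfolding \<K>_def by blast
      \<comment> \<open>There are as many summands as pieces in the family, so each piece is used
        once and exactly one summand, \<open>i0\<close>, is exceptional.\<close>
      have inj: "inj_on \<alpha> {..<w+z}"
        by (rule eq_card_imp_inj_on) (use r in \<open>simp_all add: card_cartesian_product j_def flip: K_def\<close>)
      have "(r, 0) \<in> K" using r j0 by simp
      then obtain i0 where i0: "i0 < w + z" "\<alpha> i0 = (r, 0)" unfolding K_def by auto
      have fst_\<alpha>: "fst (\<alpha> i) = r" if "i < w + z" for i
      proof -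
        have "\<alpha> i \<in> {r} \<times> {..<j}" using that r(2) unfolding K_def by blast
        then show ?thesis by auto
      qed
      have snd_\<alpha>: "snd (\<alpha> i) = 0 \<longleftrightarrow> i = i0" if "i < w + z" for i
        using inj_onD[OF inj, of i i0] that i0 fst_\<alpha>[OF that] by (auto simp: prod_eq_iff)
      have "[g = (\<Sum>i<w+z. sg w i * (if i = i0 then (1 + \<delta>) * int r else int r))] (mod int p1)"
        unfolding g
      proof (intro cong_sum cong_scalar_left)
        fix i assume "i \<in> {..<w+z}"
        then have i: "i < w + z" by simp
        show "[u i = (if i = i0 then (1 + \<delta>) * int r else int r)] (mod int p1)"
          using \<alpha>(2)[OF i] fst_\<alpha>[OF i] snd_\<alpha>[OF i] r(1)
          by (cases "i = i0") (simp_all add: piece_def res1_def)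
      qed
      then have g1: "[g = (\<delta> + sg w i0 * \<delta>) * int r] (mod int p1)"
        using i0 by (simp add: sum_sg_perturbed \<delta>_def algebra_simps)
      have "[g = (\<Sum>i<w+z. sg w i * (if i = i0 then (1 - \<delta>) * int r else int r))] (mod int p2)"
        unfolding g
      proof (intro cong_sum cong_scalar_left)
        fix i assume "i \<in> {..<w+z}"
        then have i: "i < w + z" by simp
        show "[u i = (if i = i0 then (1 - \<delta>) * int r else int r)] (mod int p2)"
          using \<alpha>(2)[OF i] fst_\<alpha>[OF i] snd_\<alpha>[OF i] r(1)
          by (cases "i = i0") (simp_all add: piece_def res2_def)
      qed
      then have g2: "[g = (\<delta> - sg w i0 * \<delta>) * int r] (mod int p2)"
        using i0 by (simp add: sum_sg_perturbed \<delta>_def algebra_simps)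
      \<comment> \<open>A plus sign at \<open>i0\<close> cancels the coefficient modulo
        \<open>p2\<close>, a minus sign the one modulo \<open>p1\<close>.\<close>
      have "int p1 dvd g \<or> int p2 dvd g"
        using g1 g2 by (cases "i0 < w") (simp_all add: sg_def cong_0_iff)
      then show ?thesis unfolding Q_def by blast
    qed
  qed
  \<comment> \<open>The multiples of \<open>p1\<close>, \<open>p2\<close> and those of the primes in
    \<open>P\<close> are bounded separately, each group with the factor
    \<open>2 * B\<close>.\<close>
  have "B * residues_count m (sum_diff_set w z S) < m"
  proof -
    let ?X = "\<lambda>Q. {n. \<exists>q\<in>Q. int q dvd n}"
    have "2 * B * residues_count m (?X {p1, p2}) < m"
    proof (rule residues_count_multiples[where Q = "{p1, p2}"])
      show "q dvd m \<and> 2 * B * card {p1, p2} < q" if "q \<in> {p1, p2}" for q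
        using that Q_dvd p12 p1 p2 by (auto simp: Q_def)
    qed (use m0 in auto)
    moreover have "2 * B * residues_count m (?X P) < m"
    proof (rule residues_count_multiples[where Q = P])
      show "q dvd m \<and> 2 * B * card P < q" if "q \<in> P" for q
        using that Q_dvd P P_gt[OF that] by (auto simp: Q_def)
    qed (use m0 P in auto)
    moreover have "residues_count m (sum_diff_set w z S) \<le> residues_count m (?X {p1, p2}) + residues_count m (?X P)"
    proof -
      have "residues_count m (sum_diff_set w z S)
          \<le> card (?X {p1, p2} \<inter> {0..<int m} \<union> ?X P \<inter> {0..<int m})"
        unfolding residues_count_def by (rule card_mono) (use sparse in \<open>auto simp: Q_def\<close>)
      also have "\<dots> \<le> residues_count m (?X {p1, p2}) + residues_count m (?X P)"
        unfolding residues_count_def by (rule card_Un_le)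
      finally show ?thesis .
    qed
    then have "B * residues_count m (sum_diff_set w z S)
        \<le> B * (residues_count m (?X {p1, p2}) + residues_count m (?X P))"
      by (rule mult_le_mono2)
    ultimately show ?thesis by (simp add: algebra_simps)
  qed
  with m0 copB' per zero full_at full_above show ?thesis by blast
qed

section \<open>Combining the levels\<close>

text \<open>Levels are treated from \<open>k\<close> downwards: the set added at level \<open>i\<close> is invisible at the levels
  above \<open>i\<close>, and its contribution at level \<open>i\<close> outweighs that of the sets added before.\<close>

lemma periodic_set_exists:
  fixes k :: nat and x y w z :: "nat \<Rightarrow> nat"
  assumes xywz: "\<And>j. 2 \<le> j \<Longrightarrow> j \<le> k \<Longrightarrow>
           x j + y j = j \<and> w j + z j = j \<and> {x j, y j} \<noteq> {w j, z j}"
    and "2 \<le> i" "i \<le> Suc k"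
  shows "\<exists>m S. m > 0 \<and> periodic m S \<and> 0 \<in> S \<and> (\<forall>j. i \<le> j \<longrightarrow> j \<le> k \<longrightarrow>
           residues_count m (sum_diff_set (w j) (z j) S) < residues_count m (sum_diff_set (x j) (y j) S))"
  using assms(3,2)
proof (induction i rule: inc_induct)
  \<comment> \<open>No level is left above \<open>k\<close>, so all integers with period 1 will
    do.\<close>
  case base
  have "(1::nat) > 0 \<and> periodic 1 UNIV \<and> (0::int) \<in> UNIV"
    by (simp add: periodic_def)
  then show ?case by (metis not_less_eq_eq)
next
  case (step i)
  then obtain m S where m: "m > 0" and S: "periodic m S" "0 \<in> S"
    and above: "\<And>j. Suc i \<le> j \<Longrightarrow> j \<le> k \<Longrightarrow>
           residues_count m (sum_diff_set (w j) (z j) S) < residues_count m (sum_diff_set (x j) (y j) S)"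
    by auto
  have i: "2 \<le> i" "i \<le> k" using step by simp_all
  have wz: "w i + z i = i" "x i + y i = i" "{x i, y i} \<noteq> {w i, z i}" using xywz[OF i] by auto
  \<comment> \<open>The current period \<open>m\<close> serves both as the number to be coprime to
    and as the sparseness factor, because \<open>S\<close> can contribute at most \<open>m\<close>
    residues.\<close>
  obtain m' S' where m': "m' > 0" and cop: "coprime m' m" and S': "periodic m' S'" "0 \<in> S'"
    and at: "\<And>x y. x + y = i \<Longrightarrow> {x, y} \<noteq> {w i, z i} \<Longrightarrow> sum_diff_set x y S' = UNIV"
    and over: "\<And>x y. x + y > i \<Longrightarrow> sum_diff_set x y S' = UNIV"
    and small: "m * residues_count m' (sum_diff_set (w i) (z i) S') < m'"
    using level_set_exists[where w = "w i" and z = "z i" and B = m and B' = m] wz(1) i(1) m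
    unfolding wz(1) by (metis (no_types, lifting) not_numeral_le_zero gr0I)
  have count: "residues_count (m' * m) (sum_diff_set a b (S' \<inter> S))
      = residues_count m' (sum_diff_set a b S') * residues_count m (sum_diff_set a b S)" if "a + b > 0" for a b
    using sum_diff_set_Int[OF S'(1) m' S(1) m cop that]
      residues_count_Int[OF periodic_sum_diff_set[OF S'(1) m' that] m' periodic_sum_diff_set[OF S(1) m that] m cop]
    by simp
  have "residues_count (m' * m) (sum_diff_set (w j) (z j) (S' \<inter> S))
      < residues_count (m' * m) (sum_diff_set (x j) (y j) (S' \<inter> S))" if j: "i \<le> j" "j \<le> k" for j
  proof -
    have wzj: "w j + z j = j" "x j + y j = j" using xywz[of j] j i by auto
    then have pos: "w j + z j > 0" "x j + y j > 0" using j i by auto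
    show ?thesis
    proof (cases "i = j")
      case False
      then have "sum_diff_set (w j) (z j) S' = UNIV" "sum_diff_set (x j) (y j) S' = UNIV"
        using over wzj j by auto
      then show ?thesis
        using above[of j] False j m' by (simp add: count[OF pos(1)] count[OF pos(2)] residues_count_UNIV)
    next
      case True
      have "residues_count (m' * m) (sum_diff_set (w j) (z j) (S' \<inter> S))
          \<le> residues_count m' (sum_diff_set (w j) (z j) S') * m"
        unfolding count[OF pos(1)] by (intro mult_le_mono2 residues_count_le)
      also have "\<dots> < m'" using small True by (simp add: mult.commute)
      \<comment> \<open>Since \<open>S\<close> contains 0, its own count on this side is at least
        1.\<close>
      also have "\<dots> \<le> m' * residues_count m (sum_diff_set (x j) (y j) S)"
        using residues_count_pos[OF periodic_sum_diff_set[OF S(1) m pos(2)] m]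
          zero_in_sum_diff_set[OF S(2)] by (auto simp: Suc_le_eq)
      also have "\<dots> = residues_count (m' * m) (sum_diff_set (x j) (y j) (S' \<inter> S))"
        unfolding count[OF pos(2)] using at[of "x j" "y j"] wz True by (simp add: residues_count_UNIV)
      finally show ?thesis .
    qed
  qed
  then show ?case
    using m m' S S' periodic_Int[OF S'(1) S(1)]
    by (intro exI[of _ "m' * m"] exI[of _ "S' \<inter> S"]) auto
qed

section \<open>From residue counts to a finite set in the plane\<close>

theorem theorem3p1:
  fixes k :: nat and x y w z :: "nat \<Rightarrow> nat"
  assumes "k \<ge> 2"
    and "\<And>j. 2 \<le> j \<Longrightarrow> j \<le> k \<Longrightarrow>
           x j + y j = j \<and> w j + z j = j \<and> {x j, y j} \<noteq> {w j, z j}"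
  shows "\<exists>A :: (int \<times> int) set. finite A \<and>
           (\<forall>j. 2 \<le> j \<longrightarrow> j \<le> k \<longrightarrow>
              card (sum_diff_set (x j) (y j) A) > card (sum_diff_set (w j) (z j) A))"
proof -
  obtain m S where m: "m > 0" and S: "periodic m S"
    and less: "\<And>j. 2 \<le> j \<Longrightarrow> j \<le> k \<Longrightarrow>
       residues_count m (sum_diff_set (w j) (z j) S) < residues_count m (sum_diff_set (x j) (y j) S)"
    using periodic_set_exists[of k x y w z 2] assms by auto
  define A where "A = S \<inter> {0..<int (m * (m + 1))}"
  let ?f = "\<lambda>n::int. (n, 0::int)"
  have card_f: "card (sum_diff_set s d (?f ` A)) = card (sum_diff_set s d A)" for s d
    by (subst sum_diff_set_image) (auto intro!: card_image inj_onI)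
  have "card (sum_diff_set (w j) (z j) A) < card (sum_diff_set (x j) (y j) A)"
    if j: "2 \<le> j" "j \<le> k" for j
  proof -
    have eq: "w j + z j = j" "x j + y j = j" using assms(2)[OF j] by auto
    define R where "R = residues_count m (sum_diff_set (w j) (z j) S)"
    have "R \<le> m" unfolding R_def by (rule residues_count_le)
    have "card (sum_diff_set (w j) (z j) A) \<le> R * (j * (m + 1) + 1)"
      using card_sum_diff_set_truncation_le[OF S m, of "w j" "z j" "m + 1"] eq j
      unfolding A_def R_def by simp
    \<comment> \<open>After expansion this is \<open>R * j < j * m + 1\<close>, so
      \<open>R \<le> m\<close> suffices; hence the choice of \<open>m + 1\<close> periods in
      \<open>A\<close>.\<close>
    also have "\<dots> < Suc R * (j * m + 1)"
      using \<open>R \<le> m\<close> by (simp add: algebra_simps less_Suc_eq_le)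
    also have "\<dots> \<le> residues_count m (sum_diff_set (x j) (y j) S) * (j * m + 1)"
      using less[OF j] by (intro mult_le_mono1) (simp add: R_def)
    also have "\<dots> \<le> card (sum_diff_set (x j) (y j) A)"
      using card_sum_diff_set_truncation_ge[OF S m, of "x j" "y j" m] eq
      unfolding A_def by simp
    finally show ?thesis .
  qed
  moreover have "finite (?f ` A)" unfolding A_def by simp
  ultimately show ?thesis
    using card_f by (intro exI[of _ "?f ` A"]) simp
qed

end
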